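(* Let $\Gamma=(V,E)$ be an infinite weighted graph and let $\Omega\subset V$ be a finite, connected subset with at least two vertices. Then $$2\bar h(\Omega)+h(\Omega)\le\lambda_{\mathrm{max}}(\Omega)\le 1+\sqrt{1-(1-\bar h(\Omega))^2}.$$
   Context: $\Gamma=(V,E)$ is a locally finite, connected graph with infinitely many vertices, equipped with symmetric edge weights $\mu_{xy}=\mu_{yx}\ge 0$, where $\mu_{xy}>0$ iff $(x,y)\in E$; self-loops ($\mu_{xx}>0$) are allowed. Put $\mu(x)=\sum_{y\in V}\mu_{xy}$. For finite $U\subset V$: $\mathrm{vol}(U)=\sum_{x\in U}\mu(x)$, $|\partial U|=\sum_{x\in U}\sum_{y\notin U}\mu_{xy}$; for finite $V_1,V_2\subset V$: $|E(V_1,V_2)|=\sum_{x\in V_1}\sum_{y\in V_2}\mu_{xy}$. A subset is connected if the subgraph of $\Gamma$ it induces is connected. Cheeger constant: $h(\Omega)=\inf\{|\partial U|/\mathrm{vol}(U):\emptyset\neq U\subset\Omega,\ U\text{ finite}\}$. Dual Cheeger constant: $\bar h(\Omega)=\sup\left\{\frac{2|E(V_1,V_2)|}{\mathrm{vol}(V_1)+\mathrm{vol}(V_2)}\right\}$, supremum over pairs of disjoint nonempty finite subsets $V_1,V_2\subset\Omega$. The Dirichlet Laplace operator on $\Omega$ acts on real functions $f$ on $\Omega$ by $\Delta_\Omega f(x)=f(x)-\frac{1}{\mu(x)}\sum_{y\in\Omega}\mu_{xy}f(y)$, $x\in\Omega$ (with $\mu(x)$ the full degree in $\Gamma$). It is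 self-adjoint with respect to $(f,g)_\mu=\sum_{x\in\Omega}\mu(x)f(x)g(x)$, and $\lambda_{\mathrm{max}}(\Omega)$ is its largest eigenvalue. *)

theory Defs
  imports "HOL-Analysis.Infinite_Sum"
begin

text \<open>A subset is connected if the subgraph it induces is connected.\<close>

definition connected_in :: "('a \<times> 'a) set \<Rightarrow> 'a set \<Rightarrow> bool" where
  "connected_in E S \<longleftrightarrow> (\<forall>x\<in>S. \<forall>y\<in>S. (x, y) \<in> (E \<inter> S \<times> S)\<^sup>*)"

text \<open>The weights are total functions on the vertex type; only their values on \<open>V \<times> V\<close> matter.
  Self-loops are allowed.\<close>

locale infinite_weighted_graph =
  fixes V :: "'a set" and E :: "('a \<times> 'a) set" and \<mu> :: "'a \<Rightarrow> 'a \<Rightarrow> real"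
  assumes infinite_V: "infinite V"
    and E_subset: "E \<subseteq> V \<times> V"
    and weight_sym: "\<And>x y. x \<in> V \<Longrightarrow> y \<in> V \<Longrightarrow> \<mu> x y = \<mu> y x"
    and weight_nonneg: "\<And>x y. x \<in> V \<Longrightarrow> y \<in> V \<Longrightarrow> \<mu> x y \<ge> 0"
    and weight_pos_iff: "\<And>x y. x \<in> V \<Longrightarrow> y \<in> V \<Longrightarrow> \<mu> x y > 0 \<longleftrightarrow> (x, y) \<in> E"
    and locally_finite: "\<And>x. x \<in> V \<Longrightarrow> finite {y. (x, y) \<in> E}"
    and connected_V: "connected_in E V"

text \<open>Sums over the infinite vertex set are written with \<^const>\<open>infsum\<close>, since \<^const>\<open>sum\<close> vanishes
  on infinite sets; by local finiteness only finitely many terms are nonzero.\<close>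

definition degree :: "'a set \<Rightarrow> ('a \<Rightarrow> 'a \<Rightarrow> real) \<Rightarrow> 'a \<Rightarrow> real" where
  "degree V \<mu> x = (\<Sum>\<^sub>\<infinity>y\<in>V. \<mu> x y)"

definition vol :: "'a set \<Rightarrow> ('a \<Rightarrow> 'a \<Rightarrow> real) \<Rightarrow> 'a set \<Rightarrow> real" where
  "vol V \<mu> U = (\<Sum>x\<in>U. degree V \<mu> x)"

definition boundary_weight :: "'a set \<Rightarrow> ('a \<Rightarrow> 'a \<Rightarrow> real) \<Rightarrow> 'a set \<Rightarrow> real" where
  "boundary_weight V \<mu> U = (\<Sum>x\<in>U. \<Sum>\<^sub>\<infinity>y\<in>V - U. \<mu> x y)"

definition edge_weight :: "('a \<Rightarrow> 'a \<Rightarrow> real) \<Rightarrow> 'a set \<Rightarrow> 'a set \<Rightarrow> real" where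
  "edge_weight \<mu> V1 V2 = (\<Sum>x\<in>V1. \<Sum>y\<in>V2. \<mu> x y)"

definition cheeger :: "'a set \<Rightarrow> ('a \<Rightarrow> 'a \<Rightarrow> real) \<Rightarrow> 'a set \<Rightarrow> real" where
  "cheeger V \<mu> \<Omega> = Inf {boundary_weight V \<mu> U / vol V \<mu> U | U.
     U \<noteq> {} \<and> U \<subseteq> \<Omega> \<and> finite U}"

definition dual_cheeger :: "'a set \<Rightarrow> ('a \<Rightarrow> 'a \<Rightarrow> real) \<Rightarrow> 'a set \<Rightarrow> real" where
  "dual_cheeger V \<mu> \<Omega> = Sup {2 * edge_weight \<mu> V1 V2 / (vol V \<mu> V1 + vol V \<mu> V2) | V1 V2.
     V1 \<noteq> {} \<and> V2 \<noteq> {} \<and> V1 \<inter> V2 = {} \<and> V1 \<subseteq> \<Omega> \<and> V2 \<subseteq> \<Omega> \<and> finite V1 \<and> finite V2}"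

text \<open>A real function on \<open>\<Omega>\<close> is represented by a total function of which only the values on
  \<open>\<Omega>\<close> are used. The operator is intended for finite \<open>\<Omega>\<close>.\<close>

definition dirichlet_laplace ::
    "'a set \<Rightarrow> ('a \<Rightarrow> 'a \<Rightarrow> real) \<Rightarrow> 'a set \<Rightarrow> ('a \<Rightarrow> real) \<Rightarrow> 'a \<Rightarrow> real" where
  "dirichlet_laplace V \<mu> \<Omega> f x = f x - 1 / degree V \<mu> x * (\<Sum>y\<in>\<Omega>. \<mu> x y * f y)"

definition dirichlet_eigenvalue ::
    "'a set \<Rightarrow> ('a \<Rightarrow> 'a \<Rightarrow> real) \<Rightarrow> 'a set \<Rightarrow> real \<Rightarrow> bool" where
  "dirichlet_eigenvalue V \<mu> \<Omega> l \<longleftrightarrow>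
     (\<exists>f. (\<exists>x\<in>\<Omega>. f x \<noteq> 0) \<and> (\<forall>x\<in>\<Omega>. dirichlet_laplace V \<mu> \<Omega> f x = l * f x))"

text \<open>Well defined for finite nonempty \<open>\<Omega>\<close>: the operator is self-adjoint with respect to the inner
  product weighted by \<^const>\<open>degree\<close>, so it has a real eigenvalue, and only finitely many.\<close>

definition lambda_max :: "'a set \<Rightarrow> ('a \<Rightarrow> 'a \<Rightarrow> real) \<Rightarrow> 'a set \<Rightarrow> real" where
  "lambda_max V \<mu> \<Omega> = (GREATEST l. dirichlet_eigenvalue V \<mu> \<Omega> l)"

end

theory Submission
  imports Defs "HOL-Analysis.Function_Topology" "HOL-Analysis.Convex"
begin

text \<open>
  Everything is governed by the quadratic form
  \<open>Q f = (\<Delta>\<^sub>\<Omega> f, f)\<^sub>\<mu> = N f - (\<Sum>x y. \<mu> x y * f x * f y)\<close>, where \<open>N f = (f, f)\<^sub>\<mu>\<close> and all sums run over \<open>\<Omega>\<close>.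
  By compactness and a first-order perturbation its maximum on \<open>N f = 1\<close> is the largest eigenvalue, so
  \<open>Q g \<le> \<lambda> * N g\<close> for \<open>\<lambda> = \<lambda>\<^sub>m\<^sub>a\<^sub>x(\<Omega>)\<close> and every \<open>g\<close> (\<open>greatest_eigenvalue\<close>).

  The lower bound is this inequality for the function that is \<open>1\<close> on \<open>A\<close>, \<open>-1\<close> on \<open>B\<close> and \<open>0\<close> elsewhere.
  Its form equals \<open>4 |E(A,B)| + |\<partial>(A \<union> B)|\<close> (\<open>form_two_valued\<close>); after division by the volume of
  \<open>A \<union> B\<close>, the first summand is twice the quotient that defines the dual Cheeger constant, and the
  second one is at least the Cheeger constant.

  For the upper bound, split an eigenfunction as \<open>f = p - n\<close> into its positive and negative parts.
  Only products of values of opposite sign can push the eigenvalue above 1: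
  \<open>(\<lambda> - 1) * N \<le> R\<close> with \<open>N = N f\<close> and \<open>R = 2 * (\<Sum>x y. \<mu> x y * p x * n y)\<close>. Put
  \<open>T = 2 * (\<Sum>x y. \<mu> x y * min ((p x)\<^sup>2) ((n y)\<^sup>2))\<close>. The product of two numbers is the product of their
  minimum and their maximum, and the minimum and the maximum add up to their sum, so the
  Cauchy-Schwarz inequality gives
  \<open>R\<^sup>2 \<le> T * (2 * N - T) = N\<^sup>2 - (N - T)\<^sup>2\<close> (\<open>opposite_sign_Cauchy_Schwarz\<close>). The superlevel sets of
  \<open>p\<^sup>2\<close> and \<open>n\<^sup>2\<close> are disjoint, so the definition of the dual Cheeger constant \<open>h\<close> applies to each level, and
  summation over the levels gives \<open>T \<le> h * N\<close> (\<open>layer_cake\<close>). As \<open>h \<le> 1\<close>, both together give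
  \<open>(R / N)\<^sup>2 \<le> 1 - (1 - h)\<^sup>2\<close>.
\<close>

section \<open>Dirichlet forms on a finite set\<close>

text \<open>
  The weights of \<open>\<Gamma>\<close> enter the Dirichlet problem only through their restriction to \<open>\<Omega>\<close> and the
  degrees. The slack in \<open>row_sum_le\<close> is the weight of the edges that leave \<open>\<Omega>\<close>, where functions
  are extended by zero.
\<close>

locale dirichlet_weights =
  fixes \<Omega> :: "'a set" and w :: "'a \<Rightarrow> 'a \<Rightarrow> real" and d :: "'a \<Rightarrow> real"
  assumes finite_\<Omega>: "finite \<Omega>"
    and nonempty_\<Omega>: "\<Omega> \<noteq> {}"
    and w_sym: "\<And>x y. x \<in> \<Omega> \<Longrightarrow> y \<in> \<Omega> \<Longrightarrow> w x y = w y x"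
    and w_nonneg: "\<And>x y. x \<in> \<Omega> \<Longrightarrow> y \<in> \<Omega> \<Longrightarrow> 0 \<le> w x y"
    and d_pos: "\<And>x. x \<in> \<Omega> \<Longrightarrow> 0 < d x"
    and row_sum_le: "\<And>x. x \<in> \<Omega> \<Longrightarrow> (\<Sum>y\<in>\<Omega>. w x y) \<le> d x"
begin

definition mass :: "('a \<Rightarrow> real) \<Rightarrow> real" where
  "mass f = (\<Sum>x\<in>\<Omega>. d x * (f x)\<^sup>2)"

text \<open>The bilinear form of the Dirichlet Laplacian in the inner product weighted by \<^term>\<open>d\<close>; the weight
  \<^term>\<open>d x\<close> cancels the division by the degree.\<close>

definition form :: "('a \<Rightarrow> real) \<Rightarrow> ('a \<Rightarrow> real) \<Rightarrow> real" where
  "form f g = (\<Sum>x\<in>\<Omega>. g x * (d x * f x - (\<Sum>y\<in>\<Omega>. w x y * f y)))"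

text \<open>The eigenvalue equation multiplied by the degree, which avoids division.\<close>

definition eigenfunction :: "real \<Rightarrow> ('a \<Rightarrow> real) \<Rightarrow> bool" where
  "eigenfunction l f \<longleftrightarrow> (\<exists>x\<in>\<Omega>. f x \<noteq> 0) \<and>
     (\<forall>x\<in>\<Omega>. d x * f x - (\<Sum>y\<in>\<Omega>. w x y * f y) = l * (d x * f x))"

lemma form_alt:
  "form f g = (\<Sum>x\<in>\<Omega>. d x * (f x * g x)) - (\<Sum>x\<in>\<Omega>. \<Sum>y\<in>\<Omega>. w x y * (f y * g x))"
  by (simp add: form_def right_diff_distrib sum_subtractf sum_distrib_left mult_ac)

lemma form_self: "form f f = mass f - (\<Sum>x\<in>\<Omega>. \<Sum>y\<in>\<Omega>. w x y * (f x * f y))"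
  by (simp add: form_alt mass_def power2_eq_square mult_ac)

lemma form_sym: "form f g = form g f"
proof -
  have "(\<Sum>x\<in>\<Omega>. \<Sum>y\<in>\<Omega>. w x y * (f y * g x)) = (\<Sum>y\<in>\<Omega>. \<Sum>x\<in>\<Omega>. w x y * (f y * g x))"
    by (rule sum.swap)
  also have "\<dots> = (\<Sum>y\<in>\<Omega>. \<Sum>x\<in>\<Omega>. w y x * (g x * f y))"
    by (intro sum.cong refl) (simp add: w_sym mult_ac)
  finally show ?thesis
    by (simp add: form_alt mult_ac)
qed

lemma form_add_right: "form f (\<lambda>x. g x + h x) = form f g + form f h"
  by (simp add: form_def distrib_right sum.distrib)

lemma form_scale_right: "form f (\<lambda>x. t * g x) = t * form f g"
  by (simp add: form_def sum_distrib_left mult_ac)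

lemma form_perturb:
  "form (\<lambda>x. f x + t * g x) (\<lambda>x. f x + t * g x) = form f f + 2 * t * form f g + t\<^sup>2 * form g g"
proof -
  let ?u = "\<lambda>x. f x + t * g x"
  have *: "form k ?u = form k f + t * form k g" for k
    by (simp add: form_add_right[of k f "\<lambda>x. t * g x"] form_scale_right)
  have "form ?u ?u = form f ?u + t * form g ?u"
    by (simp only: *[of ?u] form_sym[of ?u f] form_sym[of ?u g])
  then show ?thesis
    by (simp add: * form_sym[of g f] power2_eq_square algebra_simps)
qed

lemma mass_perturb:
  "mass (\<lambda>x. f x + t * g x) = mass f + 2 * t * (\<Sum>x\<in>\<Omega>. d x * (f x * g x)) + t\<^sup>2 * mass g"
  unfolding mass_def sum_distrib_left sum.distrib[symmetric]
  by (intro sum.cong refl) (simp add: power2_eq_square algebra_simps)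

lemma mass_nonneg: "0 \<le> mass f"
  unfolding mass_def by (intro sum_nonneg) (simp add: d_pos less_imp_le)

lemma mass_pos:
  assumes "x \<in> \<Omega>" "f x \<noteq> 0"
  shows "0 < mass f"
  unfolding mass_def
  by (rule sum_pos2[OF finite_\<Omega> assms(1)]) (use assms in \<open>auto simp: d_pos less_imp_le\<close>)

lemma form_eigenfunction:
  assumes "eigenfunction l f"
  shows "form f f = l * mass f"
proof -
  have "form f f = (\<Sum>x\<in>\<Omega>. f x * (l * (d x * f x)))"
    unfolding form_def using assms by (intro sum.cong refl) (simp add: eigenfunction_def)
  also have "\<dots> = l * mass f"
    by (simp add: mass_def sum_distrib_left power2_eq_square mult_ac)
  finally show ?thesis .
qed

section \<open>The top of the spectrum\<close>

text \<open>Functions vanishing off \<^term>\<open>\<Omega>\<close> form a finite-dimensional space, but it is used here as a subspace of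
  a function space with the product topology. Unit mass bounds every coordinate, so the set is a
  closed part of a product of compact intervals, and Tychonoff's theorem applies.\<close>

lemma compact_unit_mass: "compact {f. (\<forall>x. x \<notin> \<Omega> \<longrightarrow> f x = 0) \<and> mass f = 1}"
proof -
  define C where "C = (\<lambda>x. if x \<in> \<Omega> then {- sqrt (1 / d x) .. sqrt (1 / d x)} else {0})"
  have "compactin (product_topology (\<lambda>_. euclidean) UNIV) (Pi\<^sub>E UNIV C)"
    unfolding compactin_PiE by (auto simp: C_def)
  then have "compact (Pi\<^sub>E UNIV C)"
    by (simp add: euclidean_product_topology)
  moreover have "closed {f. mass f = 1}"
    unfolding mass_def by (intro closed_Collect_eq continuous_intros) simp_all
  ultimately have "compact (Pi\<^sub>E UNIV C \<inter> {f. mass f = 1})"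
    by (rule compact_Int_closed)
  moreover have "Pi\<^sub>E UNIV C \<inter> {f. mass f = 1} = {f. (\<forall>x. x \<notin> \<Omega> \<longrightarrow> f x = 0) \<and> mass f = 1}"
  proof -
    have "\<bar>f x\<bar> \<le> sqrt (1 / d x)" if "mass f = 1" "x \<in> \<Omega>" for f x
    proof (rule real_le_rsqrt)
      have "d x * (f x)\<^sup>2 \<le> mass f"
        unfolding mass_def
        by (rule member_le_sum[OF \<open>x \<in> \<Omega>\<close>]) (auto simp: d_pos less_imp_le finite_\<Omega>)
      then show "\<bar>f x\<bar>\<^sup>2 \<le> 1 / d x"
        using d_pos[OF \<open>x \<in> \<Omega>\<close>] that by (simp add: field_simps)
    qed
    then show ?thesis
      by (fastforce simp: C_def PiE_iff abs_le_iff split: if_splits)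
  qed
  ultimately show ?thesis
    by simp
qed

text \<open>A maximum on the compact set of unit mass is a maximum of the Rayleigh quotient over all
  functions, since both quadratic forms scale alike and ignore values off \<^term>\<open>\<Omega>\<close>.\<close>

lemma rayleigh_maximiser:
  "\<exists>f. mass f = 1 \<and> (\<forall>g. form g g \<le> form f f * mass g)"
proof -
  let ?S = "{f. (\<forall>x. x \<notin> \<Omega> \<longrightarrow> f x = 0) \<and> mass f = 1}"
  define unit where "unit = (\<lambda>g x. if x \<in> \<Omega> then (1 / sqrt (mass g)) * g x else 0 :: real)"
  have unit: "unit g \<in> ?S" "form (unit g) (unit g) * mass g = form g g" if "0 < mass g" for g
  proof -
    have "mass (unit g) = (\<Sum>x\<in>\<Omega>. (1 / mass g) * (d x * (g x)\<^sup>2))"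
      unfolding mass_def[of "unit g"] using that
      by (intro sum.cong refl) (simp add: unit_def power_mult_distrib power_divide)
    also have "\<dots> = 1"
      using that by (simp add: mass_def flip: sum_divide_distrib)
    finally show "unit g \<in> ?S"
      by (simp add: unit_def)
    have "form (unit g) (unit g) = form (\<lambda>x. (1 / sqrt (mass g)) * g x) (\<lambda>x. (1 / sqrt (mass g)) * g x)"
      unfolding form_def by (intro sum.cong refl) (simp add: unit_def)
    also have "\<dots> = (1 / sqrt (mass g)) * ((1 / sqrt (mass g)) * form g g)"
      using form_scale_right form_sym by metis
    also have "\<dots> = form g g / mass g"
      using that by simp
    finally show "form (unit g) (unit g) * mass g = form g g"
      using that by simp
  qed
  obtain x0 where "x0 \<in> \<Omega>"
    using nonempty_\<Omega> by blast
  then have "?S \<noteq> {}"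
    using unit(1)[OF mass_pos[of x0 "\<lambda>_. 1"]] by auto
  moreover have "continuous_on ?S (\<lambda>f. form f f)"
    unfolding form_def
    by (intro continuous_intros continuous_on_subset[OF continuous_on_product_coordinates]) simp_all
  ultimately have "\<exists>f\<in>?S. \<forall>g\<in>?S. form g g \<le> form f f"
    by (rule continuous_attains_sup[OF compact_unit_mass])
  then obtain f where f: "f \<in> ?S" "\<And>g. g \<in> ?S \<Longrightarrow> form g g \<le> form f f"
    by blast
  have "form g g \<le> form f f * mass g" for g
  proof (cases "0 < mass g")
    case True
    then show ?thesis
      using f(2)[OF unit(1)[OF True]] unit(2)[OF True] mult_right_mono[of _ _ "mass g"]
      by (metis less_imp_le)
  next
    case False
    then have "\<forall>x\<in>\<Omega>. g x = 0"
      using mass_pos by blast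
    then show ?thesis
      by (simp add: form_def mass_def)
  qed
  with f(1) show ?thesis
    by blast
qed

text \<open>The first-order condition at a minimum: a parabola through the origin that stays nonnegative
  has a horizontal tangent there.\<close>

lemma linear_term_zero:
  fixes a b :: real
  assumes "\<And>t. 0 \<le> a * t\<^sup>2 + b * t"
  shows "b = 0"
proof (rule ccontr)
  assume "b \<noteq> 0"
  \<comment> \<open>Opposite in sign to \<open>b\<close> and so small that the linear term dominates. The summand \<open>1\<close> covers \<open>a = 0\<close>.\<close>
  define t where "t = - b / (\<bar>a\<bar> + 1)"
  have "a * t\<^sup>2 \<le> (\<bar>a\<bar> + 1) * t\<^sup>2 - t\<^sup>2"
    by (simp add: algebra_simps mult_right_mono)
  moreover have "(\<bar>a\<bar> + 1) * t\<^sup>2 + b * t = 0"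
    by (simp add: t_def power2_eq_square)
  moreover have "0 < t\<^sup>2"
    using \<open>b \<noteq> 0\<close> by (simp add: t_def)
  ultimately show False
    using assms[of t] by linarith
qed

text \<open>The form \<open>g \<mapsto> form f f * mass g - form g g\<close> is nonnegative and vanishes at the maximiser \<open>f\<close>, so its
  derivative at \<open>f\<close> vanishes in every direction. The direction of a point mass at \<open>x\<close>
  gives the eigenvalue equation at \<open>x\<close>.\<close>

lemma maximiser_is_eigenfunction:
  assumes "mass f = 1" and max: "\<And>g. form g g \<le> form f f * mass g"
  shows "eigenfunction (form f f) f"
proof -
  let ?l = "form f f"
  have "d x * f x - (\<Sum>y\<in>\<Omega>. w x y * f y) = ?l * (d x * f x)" if "x \<in> \<Omega>" for x
  proof -
    let ?e = "\<lambda>y. if y = x then 1 else 0 :: real"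
    let ?ip = "\<Sum>y\<in>\<Omega>. d y * (f y * ?e y)"
    have "0 \<le> (?l * mass ?e - form ?e ?e) * t\<^sup>2 + (2 * (?l * ?ip - form f ?e)) * t" for t
      using max[of "\<lambda>y. f y + t * ?e y"] \<open>mass f = 1\<close>
      unfolding form_perturb mass_perturb by (simp add: algebra_simps)
    then have "?l * ?ip - form f ?e = 0"
      using linear_term_zero by fastforce
    moreover have "?ip = d x * f x"
      using that finite_\<Omega> by (simp add: if_distrib[of "\<lambda>z. _ * z"] cong: if_cong)
    moreover have "form f ?e = d x * f x - (\<Sum>y\<in>\<Omega>. w x y * f y)"
      using that finite_\<Omega> by (simp add: form_def if_distrib[of "\<lambda>z. z * _"] cong: if_cong)
    ultimately show ?thesis
      by simp
  qed
  moreover have "\<exists>x\<in>\<Omega>. f x \<noteq> 0"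
    using \<open>mass f = 1\<close> unfolding mass_def by (metis (no_types, lifting) mult_zero_right
        power_zero_numeral sum.neutral zero_neq_one)
  ultimately show ?thesis
    by (simp add: eigenfunction_def)
qed

text \<open>Every eigenvalue is the Rayleigh quotient of its eigenfunctions, so none exceeds the maximum of
  the quotient, which is an eigenvalue itself. In particular the \<open>GREATEST\<close> below exists.\<close>

theorem greatest_eigenvalue:
  defines "L \<equiv> (GREATEST l. \<exists>f. eigenfunction l f)"
  shows "\<exists>f. eigenfunction L f" and "form g g \<le> L * mass g"
proof -
  obtain f where "mass f = 1 \<and> (\<forall>g. form g g \<le> form f f * mass g)"
    using rayleigh_maximiser ..
  then have f: "mass f = 1" "form g g \<le> form f f * mass g" for g
    by simp_all
  then have eig: "eigenfunction (form f f) f"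
    by (rule maximiser_is_eigenfunction)
  have "l \<le> form f f" if "eigenfunction l k" for l k
  proof -
    have "0 < mass k"
      using that mass_pos by (auto simp: eigenfunction_def)
    moreover have "l * mass k \<le> form f f * mass k"
      using f(2)[of k] form_eigenfunction[OF that] by simp
    ultimately show ?thesis
      by simp
  qed
  then have "L = form f f"
    unfolding L_def using eig by (intro Greatest_equality) auto
  then show "\<exists>f. eigenfunction L f" and "form g g \<le> L * mass g"
    using eig f(2) by auto
qed

section \<open>The lower bound\<close>

lemma sum_indicator_diff:
  fixes F :: "'a \<Rightarrow> real"
  assumes "A \<subseteq> \<Omega>" "B \<subseteq> \<Omega>"
  shows "(\<Sum>x\<in>\<Omega>. F x * (indicator A x - indicator B x)) = sum F A - sum F B"
  using assms finite_\<Omega>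
  by (simp add: right_diff_distrib sum_subtractf indicator_def sum.If_cases Int_absorb1 if_distrib
      cong: if_cong)

lemma edge_weight_commute:
  assumes "A \<subseteq> \<Omega>" "B \<subseteq> \<Omega>"
  shows "edge_weight w A B = edge_weight w B A"
  unfolding edge_weight_def using assms
  by (subst sum.swap) (intro sum.cong refl, meson subsetD w_sym)

lemma edge_weight_le:
  assumes "A \<subseteq> \<Omega>" "B \<subseteq> \<Omega>"
  shows "edge_weight w A B \<le> sum d A"
  unfolding edge_weight_def
proof (rule sum_mono)
  fix x assume "x \<in> A"
  then have "(\<Sum>y\<in>B. w x y) \<le> (\<Sum>y\<in>\<Omega>. w x y)"
    using assms by (intro sum_mono2 finite_\<Omega> w_nonneg) auto
  also have "\<dots> \<le> d x"
    using \<open>x \<in> A\<close> assms by (intro row_sum_le) auto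
  finally show "(\<Sum>y\<in>B. w x y) \<le> d x" .
qed

text \<open>Edges inside \<open>A\<close> or inside \<open>B\<close> contribute nothing to the Dirichlet energy of a function that is
  constant there. An edge between \<open>A\<close> and \<open>B\<close> contributes the square of the jump 2, and an edge
  leaving \<open>A \<union> B\<close> the square of the jump 1. The last sum below is the boundary weight
  of \<open>A \<union> B\<close>.\<close>

lemma form_two_valued:
  assumes "A \<subseteq> \<Omega>" "B \<subseteq> \<Omega>" "A \<inter> B = {}"
  defines "f \<equiv> (\<lambda>x. indicator A x - indicator B x)"
  shows "mass f = sum d (A \<union> B)"
    and "form f f = 4 * edge_weight w A B + (\<Sum>x\<in>A \<union> B. d x - (\<Sum>y\<in>A \<union> B. w x y))"
proof -
  have fin: "finite A" "finite B"
    using assms(1,2) finite_\<Omega> by (auto intro: finite_subset)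
  have "mass f = (\<Sum>x\<in>\<Omega>. d x * indicator (A \<union> B) x)"
    unfolding mass_def f_def using assms(3) by (intro sum.cong refl) (auto simp: indicator_def)
  also have "\<dots> = sum d (A \<union> B)"
    using assms finite_\<Omega> sum_indicator_diff[of "A \<union> B" "{}" d] by simp
  finally show mass: "mass f = sum d (A \<union> B)" .
  have sw: "edge_weight w B A = edge_weight w A B"
    using assms by (intro edge_weight_commute)
  have "(\<Sum>x\<in>\<Omega>. \<Sum>y\<in>\<Omega>. w x y * (f x * f y))
      = (\<Sum>x\<in>\<Omega>. (\<Sum>y\<in>\<Omega>. w x y * f y) * f x)"
    unfolding sum_distrib_right by (intro sum.cong refl) (simp add: mult_ac)
  also have "\<dots> = (\<Sum>x\<in>\<Omega>. (sum (w x) A - sum (w x) B) * f x)"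
    using assms by (simp add: sum_indicator_diff)
  also have "\<dots> = (\<Sum>x\<in>A. sum (w x) A - sum (w x) B) - (\<Sum>x\<in>B. sum (w x) A - sum (w x) B)"
    unfolding f_def using assms by (simp add: sum_indicator_diff)
  also have "\<dots> = edge_weight w A A + edge_weight w B B - 2 * edge_weight w A B"
    using sw by (simp add: edge_weight_def sum_subtractf)
  finally have "(\<Sum>x\<in>\<Omega>. \<Sum>y\<in>\<Omega>. w x y * (f x * f y))
      = edge_weight w A A + edge_weight w B B - 2 * edge_weight w A B" .
  moreover have "(\<Sum>x\<in>A \<union> B. \<Sum>y\<in>A \<union> B. w x y)
      = edge_weight w A A + edge_weight w B B + 2 * edge_weight w A B"
    using assms fin sw by (simp add: edge_weight_def sum.union_disjoint sum.distrib)
  ultimately show "form f f = 4 * edge_weight w A B + (\<Sum>x\<in>A \<union> B. d x - (\<Sum>y\<in>A \<union> B. w x y))"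
    by (simp add: form_self mass sum_subtractf)
qed

section \<open>The upper bound\<close>

text \<open>
  Both sides are linear in the superlevel sets of the pair \<open>(a, b)\<close>: the minimum of \<open>a x\<close> and \<open>b y\<close> is the
  length of the interval of levels below both. The integral over the levels is carried out as an
  induction that takes off one layer at a time: the least positive value \<open>m\<close> of \<open>a + b\<close> is subtracted on
  the whole support, which shrinks the support, and the removed layer satisfies the inequality
  by the assumption on pairs of sets.
\<close>

lemma layer_cake:
  assumes "0 \<le> h"
    and ratio: "\<And>A B. \<lbrakk>A \<noteq> {}; B \<noteq> {}; A \<inter> B = {}; A \<subseteq> \<Omega>; B \<subseteq> \<Omega>\<rbrakk>
      \<Longrightarrow> 2 * edge_weight w A B \<le> h * sum d (A \<union> B)"
    and "\<And>x. x \<in> \<Omega> \<Longrightarrow> 0 \<le> a x" "\<And>x. x \<in> \<Omega> \<Longrightarrow> 0 \<le> b x"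
    and "\<And>x. x \<in> \<Omega> \<Longrightarrow> a x = 0 \<or> b x = 0"
  shows "2 * (\<Sum>x\<in>\<Omega>. \<Sum>y\<in>\<Omega>. w x y * min (a x) (b y)) \<le> h * (\<Sum>x\<in>\<Omega>. d x * (a x + b x))"
  using assms(3-)
proof (induction "card {x\<in>\<Omega>. 0 < a x + b x}" arbitrary: a b rule: less_induct)
  case less
  define A where "A = {x\<in>\<Omega>. 0 < a x}"
  define B where "B = {x\<in>\<Omega>. 0 < b x}"
  have AB: "A \<subseteq> \<Omega>" "B \<subseteq> \<Omega>" "A \<inter> B = {}"
    using less.prems(3) by (fastforce simp: A_def B_def)+
  have supp: "{x\<in>\<Omega>. 0 < a x + b x} = A \<union> B"
    using less.prems unfolding A_def B_def by (fastforce simp: add_pos_nonneg add_nonneg_pos)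
  have fin: "finite (A \<union> B)"
    using AB finite_\<Omega> finite_subset by auto
  show ?case
  proof (cases "A \<union> B = {}")
    case True
    then have "a x = 0" "b x = 0" if "x \<in> \<Omega>" for x
      using that less.prems(1,2)[OF that] by (force simp: A_def B_def)+
    then show ?thesis
      by simp
  next
    case False
    define m where "m = Min ((\<lambda>x. a x + b x) ` (A \<union> B))"
    have m_le: "m \<le> a x + b x" if "x \<in> A \<union> B" for x
      unfolding m_def using that fin by simp
    have "m \<in> (\<lambda>x. a x + b x) ` (A \<union> B)"
      unfolding m_def using False fin by (intro Min_in) auto
    then obtain z where z: "z \<in> A \<union> B" "a z + b z = m"
      by auto
    then have "0 < m"
      using supp by blast
    have mA: "m \<le> a x" "b x = 0" if "x \<in> A" for x
      using that m_le[of x] less.prems(3)[of x] by (auto simp: A_def)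
    have mB: "m \<le> b x" "a x = 0" if "x \<in> B" for x
      using that m_le[of x] less.prems(3)[of x] by (auto simp: B_def)
    have nA: "a x = 0" if "x \<in> \<Omega>" "x \<notin> A" for x
      using that less.prems(1)[of x] by (auto simp: A_def)
    have nB: "b x = 0" if "x \<in> \<Omega>" "x \<notin> B" for x
      using that less.prems(2)[of x] by (auto simp: B_def)
    define a' where "a' = (\<lambda>x. a x - m * indicator A x)"
    define b' where "b' = (\<lambda>x. b x - m * indicator B x)"
    have nonneg: "0 \<le> a' x" "0 \<le> b' x" "a' x = 0 \<or> b' x = 0" if "x \<in> \<Omega>" for x
      using that mA[of x] mB[of x] nA[of x] nB[of x] AB less.prems
      by (auto simp: a'_def b'_def indicator_def)
    have "{x\<in>\<Omega>. 0 < a' x + b' x} \<subseteq> A \<union> B"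
    proof
      fix x assume "x \<in> {x\<in>\<Omega>. 0 < a' x + b' x}"
      then show "x \<in> A \<union> B"
        using nA[of x] nB[of x] by (cases "x \<in> A \<union> B") (auto simp: a'_def b'_def)
    qed
    moreover have "z \<notin> {x\<in>\<Omega>. 0 < a' x + b' x}"
      using z AB by (auto simp: a'_def b'_def indicator_def)
    ultimately have "{x\<in>\<Omega>. 0 < a' x + b' x} \<subset> A \<union> B"
      using z by blast
    then have "card {x\<in>\<Omega>. 0 < a' x + b' x} < card {x\<in>\<Omega>. 0 < a x + b x}"
      unfolding supp using fin by (rule psubset_card_mono[rotated])
    then have IH: "2 * (\<Sum>x\<in>\<Omega>. \<Sum>y\<in>\<Omega>. w x y * min (a' x) (b' y))
        \<le> h * (\<Sum>x\<in>\<Omega>. d x * (a' x + b' x))"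
      by (rule less.hyps) (use nonneg in auto)
    \<comment> \<open>If only one of the two indicators is 1, both minima are 0.\<close>
    have split_min: "min (a x) (b y) = m * (indicator A x * indicator B y) + min (a' x) (b' y)"
      if "x \<in> \<Omega>" "y \<in> \<Omega>" for x y
      using that mA[of x] mB[of y] nA[of x] nB[of y] nonneg[of x] nonneg[of y] \<open>0 < m\<close>
      by (auto simp: a'_def b'_def indicator_def min_def)
    \<comment> \<open>The assumption speaks of nonempty sets only; otherwise the left side is 0.\<close>
    have level: "2 * edge_weight w A B \<le> h * sum d (A \<union> B)"
    proof (cases "A = {} \<or> B = {}")
      case True
      have "0 \<le> sum d (A \<union> B)"
        using AB d_pos by (intro sum_nonneg) (meson UnE less_imp_le subsetD)
      with True \<open>0 \<le> h\<close> show ?thesis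
        by (auto simp: edge_weight_def)
    qed (use ratio AB in auto)
    have E: "(\<Sum>x\<in>\<Omega>. \<Sum>y\<in>\<Omega>. w x y * (indicator A x * indicator B y)) = edge_weight w A B"
    proof -
      have "(\<Sum>x\<in>\<Omega>. \<Sum>y\<in>\<Omega>. w x y * (indicator A x * indicator B y))
          = (\<Sum>x\<in>\<Omega>. (\<Sum>y\<in>\<Omega>. w x y * indicator B y) * indicator A x)"
        unfolding sum_distrib_right by (intro sum.cong refl) (simp add: mult_ac)
      then show ?thesis
        using AB sum_indicator_diff[of _ "{}"] by (simp add: edge_weight_def)
    qed
    have D: "(\<Sum>x\<in>\<Omega>. d x * (indicator A x + indicator B x)) = sum d (A \<union> B)"
      using AB sum_indicator_diff[of _ "{}" d] fin
      by (simp add: distrib_left sum.distrib sum.union_disjoint)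
    have "2 * (\<Sum>x\<in>\<Omega>. \<Sum>y\<in>\<Omega>. w x y * min (a x) (b y))
        = 2 * (\<Sum>x\<in>\<Omega>. \<Sum>y\<in>\<Omega>. m * (w x y * (indicator A x * indicator B y))
            + w x y * min (a' x) (b' y))"
      by (simp add: split_min algebra_simps)
    also have "\<dots> = m * (2 * edge_weight w A B) + 2 * (\<Sum>x\<in>\<Omega>. \<Sum>y\<in>\<Omega>. w x y * min (a' x) (b' y))"
      by (simp add: sum.distrib E flip: sum_distrib_left)
    also have "\<dots> \<le> m * (h * sum d (A \<union> B)) + h * (\<Sum>x\<in>\<Omega>. d x * (a' x + b' x))"
      using IH level \<open>0 < m\<close> by (intro add_mono mult_left_mono) auto
    also have "\<dots> = h * (\<Sum>x\<in>\<Omega>. m * (d x * (indicator A x + indicator B x)) + d x * (a' x + b' x))"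
      by (simp only: sum.distrib D flip: sum_distrib_left) (simp add: algebra_simps)
    also have "\<dots> = h * (\<Sum>x\<in>\<Omega>. d x * (a x + b x))"
      by (simp add: a'_def b'_def algebra_simps)
    finally show ?thesis .
  qed
qed

text \<open>
  The plain Cauchy-Schwarz inequality for \<open>w x y * (p x * n y)\<close> would lose the information about which
  pairs of values are unbalanced. Factoring the square of \<open>p x * n y\<close> as minimum times maximum of the two squares
  keeps it: the sum with minima is \<open>T\<close>, and the sum with maxima is at most
  \<open>2 * (mass p + mass n) - T\<close>, because the row sums are bounded by the degrees.
\<close>

lemma opposite_sign_Cauchy_Schwarz:
  assumes "\<And>x. x \<in> \<Omega> \<Longrightarrow> 0 \<le> p x" "\<And>x. x \<in> \<Omega> \<Longrightarrow> 0 \<le> n x"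
  defines "T \<equiv> 2 * (\<Sum>x\<in>\<Omega>. \<Sum>y\<in>\<Omega>. w x y * min ((p x)\<^sup>2) ((n y)\<^sup>2))"
  shows "(2 * (\<Sum>x\<in>\<Omega>. \<Sum>y\<in>\<Omega>. w x y * (p x * n y)))\<^sup>2 \<le> T * (2 * (mass p + mass n) - T)"
proof -
  let ?mn = "\<lambda>(x,y). w x y * min ((p x)\<^sup>2) ((n y)\<^sup>2)"
  let ?mx = "\<lambda>(x,y). w x y * max ((p x)\<^sup>2) ((n y)\<^sup>2)"
  let ?I = "\<Omega> \<times> \<Omega>"
  have nn: "0 \<le> ?mn i" "0 \<le> ?mx i" if "i \<in> ?I" for i
    using that by (auto simp: w_nonneg le_max_iff_disj)
  have prod: "sqrt (?mn i) * sqrt (?mx i) = (case i of (x,y) \<Rightarrow> w x y * (p x * n y))"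
    if i_in: "i \<in> ?I" for i
  proof -
    obtain x y where i: "i = (x, y)" "x \<in> \<Omega>" "y \<in> \<Omega>"
      using i_in by (rule SigmaE)
    have "?mn i * ?mx i = (w x y * (p x * n y))\<^sup>2"
      by (simp add: i min_def max_def power2_eq_square)
    moreover have "0 \<le> w x y * (p x * n y)"
      using i assms w_nonneg by simp
    ultimately show ?thesis
      unfolding real_sqrt_mult[symmetric] by (simp only: real_sqrt_abs) (simp add: i)
  qed
  have T: "T = 2 * sum ?mn ?I"
    by (simp add: T_def sum.cartesian_product)
  have "(\<Sum>i\<in>?I. sqrt (?mn i) * sqrt (?mx i))\<^sup>2
      \<le> (\<Sum>i\<in>?I. (sqrt (?mn i))\<^sup>2) * (\<Sum>i\<in>?I. (sqrt (?mx i))\<^sup>2)"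
    by (rule Cauchy_Schwarz_ineq_sum)
  also have "\<dots> = sum ?mn ?I * sum ?mx ?I"
    using nn by (intro arg_cong2[of _ _ _ _ "(*)"] sum.cong refl) (auto simp: w_nonneg)
  finally have "(\<Sum>i\<in>?I. sqrt (?mn i) * sqrt (?mx i))\<^sup>2 \<le> sum ?mn ?I * sum ?mx ?I" .
  moreover have "(\<Sum>i\<in>?I. sqrt (?mn i) * sqrt (?mx i)) = (\<Sum>x\<in>\<Omega>. \<Sum>y\<in>\<Omega>. w x y * (p x * n y))"
    unfolding sum.cartesian_product by (rule sum.cong[OF refl prod])
  ultimately have CS: "(2 * (\<Sum>x\<in>\<Omega>. \<Sum>y\<in>\<Omega>. w x y * (p x * n y)))\<^sup>2 \<le> T * (2 * sum ?mx ?I)"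
    by (simp add: T power_mult_distrib)
  have "sum ?mx ?I + sum ?mn ?I = (\<Sum>(x,y)\<in>?I. w x y * (p x)\<^sup>2 + w x y * (n y)\<^sup>2)"
    unfolding sum.distrib[symmetric]
    by (intro sum.cong refl) (auto simp: min_def max_def algebra_simps)
  also have "\<dots> = (\<Sum>x\<in>\<Omega>. (\<Sum>y\<in>\<Omega>. w x y) * (p x)\<^sup>2) + (\<Sum>x\<in>\<Omega>. \<Sum>y\<in>\<Omega>. w x y * (n y)\<^sup>2)"
    by (simp add: sum.distrib sum_distrib_right flip: sum.cartesian_product)
  also have "(\<Sum>x\<in>\<Omega>. \<Sum>y\<in>\<Omega>. w x y * (n y)\<^sup>2) = (\<Sum>y\<in>\<Omega>. (\<Sum>x\<in>\<Omega>. w y x) * (n y)\<^sup>2)"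
    by (subst sum.swap) (auto simp: sum_distrib_right w_sym intro!: sum.cong)
  also have "(\<Sum>x\<in>\<Omega>. (\<Sum>y\<in>\<Omega>. w x y) * (p x)\<^sup>2) + \<dots> \<le> mass p + mass n"
    unfolding mass_def by (intro add_mono sum_mono mult_right_mono row_sum_le) auto
  finally have "2 * sum ?mx ?I \<le> 2 * (mass p + mass n) - T"
    by (simp add: T)
  moreover have "0 \<le> T"
    unfolding T using nn(1) by (simp add: sum_nonneg)
  ultimately show ?thesis
    using CS mult_left_mono order_trans by blast
qed

text \<open>The assumption \<open>ratio\<close> says that \<open>h\<close> is at least the dual Cheeger constant.\<close>

theorem eigenvalue_upper_bound:
  assumes "0 \<le> h" "h \<le> 1"
    and ratio: "\<And>A B. \<lbrakk>A \<noteq> {}; B \<noteq> {}; A \<inter> B = {}; A \<subseteq> \<Omega>; B \<subseteq> \<Omega>\<rbrakk>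
      \<Longrightarrow> 2 * edge_weight w A B \<le> h * sum d (A \<union> B)"
    and eig: "eigenfunction l f"
  shows "l \<le> 1 + sqrt (1 - (1 - h)\<^sup>2)"
proof -
  define p where "p = (\<lambda>x. max (f x) 0)"
  define n where "n = (\<lambda>x. max (- f x) 0)"
  define R where "R = 2 * (\<Sum>x\<in>\<Omega>. \<Sum>y\<in>\<Omega>. w x y * (p x * n y))"
  define T where "T = 2 * (\<Sum>x\<in>\<Omega>. \<Sum>y\<in>\<Omega>. w x y * min ((p x)\<^sup>2) ((n y)\<^sup>2))"
  define N where "N = mass f"
  have "0 < N"
    unfolding N_def using eig mass_pos by (auto simp: eigenfunction_def)
  have N: "mass p + mass n = N"
    unfolding N_def mass_def sum.distrib[symmetric]
    by (intro sum.cong refl) (auto simp: p_def n_def max_def)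
  have "T \<le> h * (\<Sum>x\<in>\<Omega>. d x * ((p x)\<^sup>2 + (n x)\<^sup>2))"
    unfolding T_def by (rule layer_cake[OF \<open>0 \<le> h\<close> ratio]) (auto simp: p_def n_def max_def)
  also have "(\<Sum>x\<in>\<Omega>. d x * ((p x)\<^sup>2 + (n x)\<^sup>2)) = N"
    by (simp add: mass_def distrib_left sum.distrib flip: N)
  finally have "T \<le> h * N" .
  have "R\<^sup>2 \<le> T * (2 * N - T)"
    unfolding R_def T_def N[symmetric]
    by (rule opposite_sign_Cauchy_Schwarz) (auto simp: p_def n_def)
  also have "\<dots> = N\<^sup>2 - (N - T)\<^sup>2"
    by (simp add: power2_eq_square algebra_simps)
  \<comment> \<open>Squaring is monotone here since \<open>(1 - h) * N\<close> is nonnegative; this is where \<open>h \<le> 1\<close> enters.\<close>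
  also have "\<dots> \<le> N\<^sup>2 - ((1 - h) * N)\<^sup>2"
    using \<open>T \<le> h * N\<close> \<open>0 < N\<close> \<open>h \<le> 1\<close>
    by (intro diff_left_mono power_mono) (auto simp: algebra_simps mult_left_le_one_le)
  also have "\<dots> = N\<^sup>2 * (1 - (1 - h)\<^sup>2)"
    unfolding power_mult_distrib by (simp add: right_diff_distrib mult.commute)
  finally have "R\<^sup>2 \<le> N\<^sup>2 * (1 - (1 - h)\<^sup>2)" .
  then have "R \<le> sqrt (N\<^sup>2 * (1 - (1 - h)\<^sup>2))"
    by (rule real_le_rsqrt)
  then have "R \<le> N * sqrt (1 - (1 - h)\<^sup>2)"
    using \<open>0 < N\<close> by (simp add: real_sqrt_mult)
  moreover have "- R \<le> (\<Sum>x\<in>\<Omega>. \<Sum>y\<in>\<Omega>. w x y * (f x * f y))"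
  proof -
    have "- R = (\<Sum>x\<in>\<Omega>. \<Sum>y\<in>\<Omega>. w x y * - (p x * n y)) + (\<Sum>x\<in>\<Omega>. \<Sum>y\<in>\<Omega>. w x y * - (p x * n y))"
      by (simp add: R_def sum_negf)
    \<comment> \<open>Exchanging \<open>x\<close> and \<open>y\<close> in one copy yields both mixed products in \<open>f x * f y\<close>.\<close>
    also have "(\<Sum>x\<in>\<Omega>. \<Sum>y\<in>\<Omega>. w x y * - (p x * n y)) + (\<Sum>x\<in>\<Omega>. \<Sum>y\<in>\<Omega>. w x y * - (p x * n y))
        = (\<Sum>x\<in>\<Omega>. \<Sum>y\<in>\<Omega>. w x y * - (p x * n y)) + (\<Sum>x\<in>\<Omega>. \<Sum>y\<in>\<Omega>. w x y * - (p y * n x))"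
      by (subst (2) sum.swap) (auto simp: w_sym intro!: sum.cong arg_cong2[of _ _ _ _ "(+)"])
    also have "\<dots> = (\<Sum>x\<in>\<Omega>. \<Sum>y\<in>\<Omega>. w x y * (- (p x * n y) - p y * n x))"
      unfolding sum.distrib[symmetric] by (intro sum.cong refl) (simp add: algebra_simps)
    also have "\<dots> \<le> (\<Sum>x\<in>\<Omega>. \<Sum>y\<in>\<Omega>. w x y * (f x * f y))"
    proof (intro sum_mono mult_left_mono w_nonneg)
      fix x y
      have "f x * f y = p x * p y + n x * n y - p x * n y - p y * n x"
        by (simp add: p_def n_def max_def)
      moreover have "0 \<le> p x * p y + n x * n y"
        by (simp add: p_def n_def)
      ultimately show "- (p x * n y) - p y * n x \<le> f x * f y"
        by linarith
    qed
    finally show ?thesis .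
  qed
  ultimately have "l * N \<le> N * (1 + sqrt (1 - (1 - h)\<^sup>2))"
    using form_eigenfunction[OF eig] form_self[of f] by (simp add: N_def algebra_simps)
  then show ?thesis
    using \<open>0 < N\<close> by (simp add: mult.commute)
qed

end

section \<open>Infinite weighted graphs\<close>

context infinite_weighted_graph
begin

lemma summable_weight:
  assumes "x \<in> V" "A \<subseteq> V"
  shows "\<mu> x summable_on A"
proof (rule finite_nonzero_values_imp_summable_on)
  have "{y \<in> A. \<mu> x y \<noteq> 0} \<subseteq> {y. (x, y) \<in> E}"
    using assms weight_nonneg[of x] weight_pos_iff[of x] by force
  then show "finite {y \<in> A. \<mu> x y \<noteq> 0}"
    using locally_finite[OF assms(1)] finite_subset by blast
qed

lemma degree_split:
  assumes "x \<in> V" "U \<subseteq> V" "finite U"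
  shows "degree V \<mu> x = (\<Sum>y\<in>U. \<mu> x y) + (\<Sum>\<^sub>\<infinity>y\<in>V - U. \<mu> x y)"
proof -
  have "(\<Sum>\<^sub>\<infinity>y\<in>U \<union> (V - U). \<mu> x y) = (\<Sum>\<^sub>\<infinity>y\<in>U. \<mu> x y) + (\<Sum>\<^sub>\<infinity>y\<in>V - U. \<mu> x y)"
    by (rule infsum_Un_disjoint) (use assms in \<open>auto intro!: summable_weight\<close>)
  with assms show ?thesis
    by (simp add: degree_def Un_absorb1)
qed

lemma boundary_weight_eq:
  assumes "U \<subseteq> V" "finite U"
  shows "boundary_weight V \<mu> U = (\<Sum>x\<in>U. degree V \<mu> x - (\<Sum>y\<in>U. \<mu> x y))"
  unfolding boundary_weight_def
proof (intro sum.cong refl)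
  fix x assume "x \<in> U"
  then show "(\<Sum>\<^sub>\<infinity>y\<in>V - U. \<mu> x y) = degree V \<mu> x - (\<Sum>y\<in>U. \<mu> x y)"
    using degree_split[of x U] assms by auto
qed

lemma row_sum_le_degree:
  assumes "x \<in> V" "U \<subseteq> V" "finite U"
  shows "(\<Sum>y\<in>U. \<mu> x y) \<le> degree V \<mu> x"
  using assms by (auto simp: degree_split intro!: infsum_nonneg weight_nonneg)

text \<open>A point of \<open>\<Omega>\<close> has positive degree because a path inside \<open>\<Omega>\<close> to a second point starts with
  an edge.\<close>

lemma dirichlet_weights_degree:
  assumes "\<Omega> \<subseteq> V" "finite \<Omega>" "connected_in E \<Omega>" "card \<Omega> \<ge> 2"
  shows "dirichlet_weights \<Omega> \<mu> (degree V \<mu>)"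
proof
  show "0 < degree V \<mu> x" if x: "x \<in> \<Omega>" for x
  proof -
    have "\<Omega> \<noteq> {x}"
      using assms(4) by auto
    then obtain y where "y \<in> \<Omega>" "y \<noteq> x"
      using x by blast
    then have "(x, y) \<in> (E \<inter> \<Omega> \<times> \<Omega>)\<^sup>*"
      using assms(3) x by (auto simp: connected_in_def)
    with \<open>y \<noteq> x\<close> obtain z where z: "(x, z) \<in> E" "z \<in> \<Omega>"
      by (auto elim: converse_rtranclE)
    have "0 < \<mu> x z"
      using z weight_pos_iff assms(1) x by blast
    also have "\<mu> x z \<le> (\<Sum>y\<in>\<Omega>. \<mu> x y)"
      using assms x z by (intro member_le_sum) (auto intro!: weight_nonneg)
    also have "\<dots> \<le> degree V \<mu> x"
      using assms x by (intro row_sum_le_degree) auto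
    finally show ?thesis .
  qed
  show "\<Omega> \<noteq> {}"
    using assms(4) by auto
qed (use assms in \<open>auto intro: weight_sym weight_nonneg row_sum_le_degree\<close>)

end

theorem theorem4p5:
  fixes V :: "'a set" and E :: "('a \<times> 'a) set" and \<mu> :: "'a \<Rightarrow> 'a \<Rightarrow> real" and \<Omega> :: "'a set"
  assumes "infinite_weighted_graph V E \<mu>"
    and "\<Omega> \<subseteq> V" and "finite \<Omega>" and "connected_in E \<Omega>" and "card \<Omega> \<ge> 2"
  shows "2 * dual_cheeger V \<mu> \<Omega> + cheeger V \<mu> \<Omega> \<le> lambda_max V \<mu> \<Omega> \<and>
    lambda_max V \<mu> \<Omega> \<le> 1 + sqrt (1 - (1 - dual_cheeger V \<mu> \<Omega>)\<^sup>2)"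
proof -
  interpret infinite_weighted_graph V E \<mu>
    by fact
  interpret dirichlet_weights \<Omega> \<mu> "degree V \<mu>"
    by (rule dirichlet_weights_degree) fact+
  let ?L = "lambda_max V \<mu> \<Omega>" and ?h = "cheeger V \<mu> \<Omega>" and ?k = "dual_cheeger V \<mu> \<Omega>"
  have "dirichlet_eigenvalue V \<mu> \<Omega> l \<longleftrightarrow> (\<exists>f. eigenfunction l f)" for l
  proof -
    have "dirichlet_laplace V \<mu> \<Omega> f x = l * f x \<longleftrightarrow>
        degree V \<mu> x * f x - (\<Sum>y\<in>\<Omega>. \<mu> x y * f y) = l * (degree V \<mu> x * f x)" if "x \<in> \<Omega>" for f x
      using d_pos[OF that] by (auto simp: dirichlet_laplace_def field_simps)
    then show ?thesis
      by (auto simp: dirichlet_eigenvalue_def eigenfunction_def)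
  qed
  then have L: "?L = (GREATEST l. \<exists>f. eigenfunction l f)"
    by (simp add: lambda_max_def)
  have vol_pos: "0 < vol V \<mu> U" if "U \<subseteq> \<Omega>" "U \<noteq> {}" for U
    unfolding vol_def using that finite_\<Omega> d_pos by (intro sum_pos) (auto intro: finite_subset)
  have vol_Un: "vol V \<mu> (A \<union> B) = vol V \<mu> A + vol V \<mu> B"
    if "A \<subseteq> \<Omega>" "B \<subseteq> \<Omega>" "A \<inter> B = {}" for A B
    unfolding vol_def using that finite_\<Omega> by (intro sum.union_disjoint) (auto intro: finite_subset)
  have cheeger_le: "?h \<le> boundary_weight V \<mu> U / vol V \<mu> U" if "U \<subseteq> \<Omega>" "U \<noteq> {}" for U
    unfolding cheeger_def
  proof (rule cInf_lower)
    show "bdd_below {boundary_weight V \<mu> U / vol V \<mu> U |U. U \<noteq> {} \<and> U \<subseteq> \<Omega> \<and> finite U}"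
    proof (rule bdd_belowI)
      fix r assume "r \<in> {boundary_weight V \<mu> U / vol V \<mu> U |U. U \<noteq> {} \<and> U \<subseteq> \<Omega> \<and> finite U}"
      then obtain U where U: "r = boundary_weight V \<mu> U / vol V \<mu> U" "U \<noteq> {}" "U \<subseteq> \<Omega>"
        by auto
      moreover have "0 \<le> boundary_weight V \<mu> U"
        unfolding boundary_weight_def using U assms(2)
        by (intro sum_nonneg infsum_nonneg weight_nonneg) auto
      ultimately show "0 \<le> r"
        using vol_pos[of U] by simp
    qed
  qed (use that finite_\<Omega> finite_subset in auto)
  let ?pair = "\<lambda>A B. A \<noteq> {} \<and> B \<noteq> {} \<and> A \<inter> B = {} \<and> A \<subseteq> \<Omega> \<and> B \<subseteq> \<Omega> \<and> finite A \<and> finite B"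
  define K where "K = {2 * edge_weight \<mu> A B / (vol V \<mu> A + vol V \<mu> B) |A B. ?pair A B}"
  have "K \<noteq> {}"
  proof -
    obtain x where "x \<in> \<Omega>"
      using nonempty_\<Omega> by blast
    moreover have "\<Omega> \<noteq> {x}"
      using assms(5) by auto
    ultimately obtain y where "y \<in> \<Omega>" "y \<noteq> x"
      by blast
    with \<open>x \<in> \<Omega>\<close> have "?pair {x} {y}"
      by auto
    then show ?thesis
      unfolding K_def by blast
  qed
  have two_valued: "4 * edge_weight \<mu> A B + boundary_weight V \<mu> (A \<union> B) \<le> ?L * vol V \<mu> (A \<union> B)"
    if "?pair A B" for A B
  proof -
    have "A \<union> B \<subseteq> V" "finite (A \<union> B)"
      using that assms(2) by auto
    then show ?thesis
      using greatest_eigenvalue(2)[of "\<lambda>x. indicator A x - indicator B x"] form_two_valued[of A B] that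
      by (simp add: boundary_weight_eq vol_def L)
  qed
  have K_bounds: "0 \<le> r" "r \<le> 1" "2 * r + ?h \<le> ?L" if r_in: "r \<in> K" for r
  proof -
    obtain A B where r: "r = 2 * edge_weight \<mu> A B / (vol V \<mu> A + vol V \<mu> B)" and AB: "?pair A B"
      using r_in unfolding K_def by blast
    let ?v = "vol V \<mu> (A \<union> B)"
    have v: "0 < ?v"
      using AB by (intro vol_pos) auto
    have r': "r * ?v = 2 * edge_weight \<mu> A B"
      using r AB v by (simp add: vol_Un)
    have E0: "0 \<le> edge_weight \<mu> A B"
      unfolding edge_weight_def using AB by (intro sum_nonneg w_nonneg) auto
    have "edge_weight \<mu> A B \<le> vol V \<mu> A" "edge_weight \<mu> A B \<le> vol V \<mu> B"
      using AB edge_weight_le[of A B] edge_weight_le[of B A] edge_weight_commute[of A B]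
      by (auto simp: vol_def)
    then have "r * ?v \<le> 1 * ?v"
      using AB r' by (simp add: vol_Un)
    moreover have "0 * ?v \<le> r * ?v"
      using E0 r' by simp
    moreover have "(2 * r + ?h) * ?v \<le> ?L * ?v"
    proof -
      have "?h * ?v \<le> boundary_weight V \<mu> (A \<union> B)"
        using cheeger_le[of "A \<union> B"] AB v by (simp add: pos_le_divide_eq)
      then show ?thesis
        using two_valued[OF AB] r' by (simp add: distrib_right)
    qed
    ultimately show "0 \<le> r" "r \<le> 1" "2 * r + ?h \<le> ?L"
      using v by (simp_all only: mult_le_cancel_right_pos)
  qed
  have k: "?k = Sup K"
    by (simp add: dual_cheeger_def K_def)
  have "bdd_above K"
    using K_bounds(2) by (rule bdd_aboveI)
  then have K_le: "r \<le> ?k" if "r \<in> K" for r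
    unfolding k using that by (rule cSup_upper[rotated])
  have K_least: "?k \<le> c" if "\<And>r. r \<in> K \<Longrightarrow> r \<le> c" for c
    unfolding k using \<open>K \<noteq> {}\<close> that by (rule cSup_least)
  have "?k \<le> (?L - ?h) / 2"
  proof (rule K_least)
    show "r \<le> (?L - ?h) / 2" if "r \<in> K" for r
      using K_bounds(3)[OF that] by simp
  qed
  moreover have "?L \<le> 1 + sqrt (1 - (1 - ?k)\<^sup>2)"
  proof -
    obtain f where f: "eigenfunction ?L f"
      using greatest_eigenvalue(1) L by auto
    obtain r where "r \<in> K"
      using \<open>K \<noteq> {}\<close> by blast
    then have "0 \<le> ?k"
      using K_bounds(1)[of r] K_le[of r] by simp
    moreover have "?k \<le> 1"
      using K_bounds(2) by (rule K_least)
    moreover have "2 * edge_weight \<mu> A B \<le> ?k * sum (degree V \<mu>) (A \<union> B)"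
      if "A \<noteq> {}" "B \<noteq> {}" "A \<inter> B = {}" "A \<subseteq> \<Omega>" "B \<subseteq> \<Omega>" for A B
    proof -
      have "?pair A B"
        using that finite_\<Omega> finite_subset by auto
      then have "2 * edge_weight \<mu> A B / (vol V \<mu> A + vol V \<mu> B) \<in> K"
        unfolding K_def by blast
      then have "2 * edge_weight \<mu> A B / (vol V \<mu> A + vol V \<mu> B) \<le> ?k"
        by (rule K_le)
      moreover have "0 < vol V \<mu> A + vol V \<mu> B"
        using that vol_pos by (simp add: add_pos_pos)
      ultimately show ?thesis
        using vol_Un[of A B] that by (simp add: pos_divide_le_eq vol_def)
    qed
    ultimately show ?thesis
      using f by (rule eigenvalue_upper_bound)
  qed
  ultimately show ?thesis
    by (simp add: field_simps)
qed

end
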